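(* Let $a,b,n$ be integers with $b\geq a\geq 1$ and $n\geq 3a+b-1$ such that $a\cdot n$ is even, and let $G$ be a graph of order $n$. If $\rho(G)>\rho(H_{n,a})$, where $H_{n,a}=K_{a-1}\nabla(K_{1}\cup K_{n-a})$, then $G$ contains an $[a,b]$-factor.
   Context: All graphs are finite, simple and undirected (not necessarily connected). The order of a graph is its number of vertices. For a graph $G$ with adjacency matrix $A(G)$, the spectral radius $\rho(G)$ is the largest eigenvalue of $A(G)$. $K_m$ is the complete graph on $m$ vertices ($K_0$ is the graph with no vertices, so $H_{n,1}=K_1\cup K_{n-1}$), $\cup$ denotes the disjoint union of graphs, and $G_1\nabla G_2$ denotes the join, obtained from the disjoint union of $G_1$ and $G_2$ by adding all edges between $V(G_1)$ and $V(G_2)$. An $[a,b]$-factor of a graph $G$ is a spanning subgraph $H$ of $G$ such that $a\leq d_H(v)\leq b$ for each $v\in V(G)$, where $d_H(v)$ is the degree of $v$ in $H$. *)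

theory Defs
  imports "Graph_Theory.Digraph_Component" "Jordan_Normal_Form.Spectral_Radius"
begin

text \<open>
  A finite simple undirected graph is a \<^locale>\<open>pair_graph\<close>: a finite vertex set with a symmetric,
  loop-free set of ordered pairs. Each edge is present in both orientations, so the
  degree of a vertex in the undirected sense is its \<^const>\<open>out_degree\<close>.
\<close>

definition complete_graph :: "nat \<Rightarrow> nat pair_pre_digraph" where
  "complete_graph m = \<lparr>pverts = {0..<m}, parcs = {(u, v). u < m \<and> v < m \<and> u \<noteq> v}\<rparr>"

definition disjoint_union ::
    "'a pair_pre_digraph \<Rightarrow> 'b pair_pre_digraph \<Rightarrow> ('a + 'b) pair_pre_digraph" where
  "disjoint_union G1 G2 =
     \<lparr>pverts = pverts G1 <+> pverts G2,
      parcs = {(Inl u, Inl v) | u v. (u, v) \<in> parcs G1} \<union> {(Inr u, Inr v) | u v. (u, v) \<in> parcs G2}\<rparr>"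

definition graph_join ::
    "'a pair_pre_digraph \<Rightarrow> 'b pair_pre_digraph \<Rightarrow> ('a + 'b) pair_pre_digraph" where
  "graph_join G1 G2 =
     \<lparr>pverts = pverts (disjoint_union G1 G2),
      parcs = parcs (disjoint_union G1 G2)
        \<union> {(Inl u, Inr v) | u v. u \<in> pverts G1 \<and> v \<in> pverts G2}
        \<union> {(Inr v, Inl u) | u v. u \<in> pverts G1 \<and> v \<in> pverts G2}\<rparr>"

text \<open>Used only for \<open>1 \<le> a \<le> n\<close>, where the truncated subtractions are exact.\<close>

definition H_graph :: "nat \<Rightarrow> nat \<Rightarrow> (nat + nat + nat) pair_pre_digraph" where
  "H_graph n a =
     graph_join (complete_graph (a - 1)) (disjoint_union (complete_graph 1) (complete_graph (n - a)))"

text \<open>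
  The matrices of the library are indexed by \<open>0..<n\<close>, so an adjacency matrix needs an enumeration
  of the vertices; its spectrum does not depend on the choice
  (lemma \<open>spectrum_adjacency_matrix_eq\<close> below).
\<close>

definition adjacency_matrix_wrt :: "'a list \<Rightarrow> 'a pair_pre_digraph \<Rightarrow> real mat" where
  "adjacency_matrix_wrt vs G =
     mat (length vs) (length vs) (\<lambda>(i, j). if (vs ! i, vs ! j) \<in> parcs G then 1 else 0)"

definition adjacency_matrix :: "'a pair_pre_digraph \<Rightarrow> real mat" where
  "adjacency_matrix G = adjacency_matrix_wrt (SOME vs. distinct vs \<and> set vs = pverts G) G"

text \<open>
  The largest (real) eigenvalue. This is not the library's \<^const>\<open>spectral_radius\<close>, which is the
  maximal modulus of the complex eigenvalues.
\<close>

definition graph_spectral_radius :: "'a pair_pre_digraph \<Rightarrow> real" where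
  "graph_spectral_radius G = Max (spectrum (adjacency_matrix G))"

text \<open>\<^const>\<open>spanning\<close> alone would admit subdigraphs containing only one orientation of an edge.\<close>

definition ab_factor :: "nat \<Rightarrow> nat \<Rightarrow> 'a pair_pre_digraph \<Rightarrow> 'a pair_pre_digraph \<Rightarrow> bool" where
  "ab_factor a b H G \<longleftrightarrow>
     pair_graph H \<and> spanning (with_proj H) (with_proj G) \<and>
     (\<forall>v \<in> pverts G. a \<le> out_degree (with_proj H) v \<and> out_degree (with_proj H) v \<le> b)"


lemma pair_graphI:
  assumes "finite (pverts G)" "parcs G \<subseteq> pverts G \<times> pverts G" "sym (parcs G)" "irrefl (parcs G)"
  shows "pair_graph G"
proof -
  have "finite (parcs G)"
    using assms(1,2) by (meson finite_SigmaI finite_subset)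
  then show ?thesis
    using assms by unfold_locales (auto simp: symmetric_def irrefl_def)
qed

lemma pair_graphD:
  assumes "pair_graph G"
  shows "finite (pverts G)" "parcs G \<subseteq> pverts G \<times> pverts G" "sym (parcs G)" "irrefl (parcs G)"
proof -
  interpret pair_graph G by fact
  show "finite (pverts G)" by (rule pair_finite_verts)
  show "parcs G \<subseteq> pverts G \<times> pverts G" by (auto dest: in_arcsD1 in_arcsD2)
  show "sym (parcs G)" by (auto intro: symI arcs_symmetric)
  show "irrefl (parcs G)" by (auto simp: irrefl_def dest: pair_no_loops)
qed

lemma pair_graph_complete_graph: "pair_graph (complete_graph m)"
  by (rule pair_graphI) (auto simp: complete_graph_def sym_def irrefl_def)

lemma pair_graph_disjoint_union:
  assumes "pair_graph G1" "pair_graph G2"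
  shows "pair_graph (disjoint_union G1 G2)"
  using pair_graphD[OF assms(1)] pair_graphD[OF assms(2)]
  by (intro pair_graphI) (auto simp: disjoint_union_def sym_def irrefl_def)

lemma pair_graph_graph_join:
  assumes "pair_graph G1" "pair_graph G2"
  shows "pair_graph (graph_join G1 G2)"
  using pair_graphD[OF assms(1)] pair_graphD[OF assms(2)]
  by (intro pair_graphI) (auto simp: graph_join_def disjoint_union_def sym_def irrefl_def)

lemma pair_graph_H_graph: "pair_graph (H_graph n a)"
  unfolding H_graph_def
  by (intro pair_graph_graph_join pair_graph_disjoint_union pair_graph_complete_graph)

lemma card_H_graph:
  assumes "1 \<le> a" "a \<le> n"
  shows "card (pverts (H_graph n a)) = n"
  using assms by (simp add: H_graph_def graph_join_def disjoint_union_def complete_graph_def card_Plus)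

lemma eigenvalue_adjacency_matrix_wrt_iff:
  assumes "distinct vs"
  shows "eigenvalue (adjacency_matrix_wrt vs G) k \<longleftrightarrow>
    (\<exists>x. (\<exists>u \<in> set vs. x u \<noteq> 0) \<and>
         (\<forall>u \<in> set vs. (\<Sum>v \<in> set vs. (if (u, v) \<in> parcs G then 1 else 0) * x v) = k * x u))"
    (is "?L \<longleftrightarrow> ?R")
proof -
  let ?n = "length vs" and ?A = "adjacency_matrix_wrt vs G"
  have reindex: "(\<Sum>v \<in> set vs. f v) = (\<Sum>j<?n. f (vs ! j))" for f :: "'a \<Rightarrow> real"
    using bij_betw_nth[OF assms refl refl] by (metis sum.reindex_bij_betw)
  have mult: "(?A *\<^sub>v vec ?n y) $ i
      = (\<Sum>j<?n. (if (vs ! i, vs ! j) \<in> parcs G then 1 else 0) * y j)" if "i < ?n" for i y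
    using that by (auto simp: adjacency_matrix_wrt_def scalar_prod_def lessThan_atLeast0 intro!: sum.cong)
  have dim: "dim_row ?A = ?n" "dim_vec (?A *\<^sub>v w) = ?n" for w
    by (simp_all add: adjacency_matrix_wrt_def)
  have vec_iff: "eigenvector ?A (vec ?n (\<lambda>i. x (vs ! i))) k \<longleftrightarrow>
      (\<exists>u \<in> set vs. x u \<noteq> 0) \<and>
      (\<forall>u \<in> set vs. (\<Sum>v \<in> set vs. (if (u, v) \<in> parcs G then 1 else 0) * x v) = k * x u)" for x
  proof -
    let ?w = "vec ?n (\<lambda>i. x (vs ! i))"
    let ?S = "\<lambda>u. \<Sum>v \<in> set vs. (if (u, v) \<in> parcs G then 1 else 0) * x v"
    have "?w = 0\<^sub>v ?n \<longleftrightarrow> (\<forall>i<?n. x (vs ! i) = 0)"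
      by (simp add: vec_eq_iff)
    then have "?w \<noteq> 0\<^sub>v ?n \<longleftrightarrow> (\<exists>u \<in> set vs. x u \<noteq> 0)"
      by (metis in_set_conv_nth)
    moreover have "?A *\<^sub>v ?w = k \<cdot>\<^sub>v ?w \<longleftrightarrow> (\<forall>i<?n. (?A *\<^sub>v ?w) $ i = k * x (vs ! i))"
      by (simp add: vec_eq_iff dim(1) del: index_mult_mat_vec)
    moreover have "\<dots> \<longleftrightarrow> (\<forall>i<?n. ?S (vs ! i) = k * x (vs ! i))"
    proof -
      have "(?A *\<^sub>v ?w) $ i = ?S (vs ! i)" if "i < ?n" for i
        unfolding mult[OF that] by (rule reindex[symmetric])
      then show ?thesis by auto
    qed
    moreover have "\<dots> \<longleftrightarrow> (\<forall>u \<in> set vs. ?S u = k * x u)"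
      by (rule all_set_conv_all_nth[symmetric])
    ultimately show ?thesis
      by (simp add: eigenvector_def dim)
  qed
  show ?thesis
  proof
    assume ?L
    then obtain w where w: "eigenvector ?A w k"
      by (auto simp: eigenvalue_def)
    then have dw: "dim_vec w = ?n"
      by (auto simp: eigenvector_def dim)
    define x where "x u = w $ (THE i. i < ?n \<and> vs ! i = u)" for u
    have "(THE j. j < ?n \<and> vs ! j = vs ! i) = i" if "i < ?n" for i
      using that assms by (intro the_equality) (auto simp: nth_eq_iff_index_eq)
    then have "w = vec ?n (\<lambda>i. x (vs ! i))"
      using dw by (auto simp: vec_eq_iff x_def)
    with w vec_iff[of x] show ?R by auto
  next
    assume ?R
    with vec_iff show ?L by (auto simp: eigenvalue_def)
  qed
qed

lemma spectrum_adjacency_matrix_eq: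
  assumes "distinct vs" "set vs = pverts G"
  shows "spectrum (adjacency_matrix G) = spectrum (adjacency_matrix_wrt vs G)"
proof -
  let ?vs = "SOME vs. distinct vs \<and> set vs = pverts G"
  have "distinct ?vs \<and> set ?vs = pverts G"
    by (rule someI[where P = "\<lambda>vs. distinct vs \<and> set vs = pverts G" and x = vs]) (simp add: assms)
  then have vs': "distinct ?vs" "set ?vs = set vs"
    using assms by simp_all
  show ?thesis
    unfolding spectrum_def adjacency_matrix_def
      eigenvalue_adjacency_matrix_wrt_iff[OF vs'(1), abs_def]
      eigenvalue_adjacency_matrix_wrt_iff[OF assms(1), abs_def] vs'(2)
    by (rule refl)
qed

end

theory Submission
  imports Defs
begin

text \<open>
  Since \<open>a n\<close> is even, it suffices to find an \<open>a\<close>-regular spanning subgraph, and \<open>n \<ge> 4 a - 1\<close>.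
  If some vertex has degree less than \<open>a\<close>, then \<open>G\<close> embeds into \<open>H(n,a)\<close> and a positive
  (super)eigenvector of \<open>H(n,a)\<close> bounds \<open>\<rho>(G)\<close> by \<open>\<rho>(H(n,a))\<close>. Otherwise the row sums of
  \<open>A\<^sup>2 - (a - 1) A\<close> are at most \<open>2 e(G) - (n - 1) a\<close>, and \<open>\<rho>(G) > \<rho>(H(n,a)) \<ge> n - 2\<close> leaves fewer than
  \<open>n - 1 - a/2\<close> edges in the complement of \<open>G\<close>.

  Among all \<open>a\<close>-regular graphs on the vertex set, take one, \<open>F\<close>, with the fewest edges in the complement
  of \<open>G\<close>. If \<open>uv\<close> is such a bad edge, no alternating closed trail of length 4 or 6 through \<open>uv\<close>
  whose new edges lie in \<open>G\<close> can exist. This forces so many pairs between the vertices at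
  \<open>F\<close>-distance one from the free neighbours of \<open>u\<close> and of \<open>v\<close> to be missing in \<open>G\<close> that the bound on the
  number of edges of the complement is violated.
\<close>

section \<open>Regular graphs and edge switching\<close>

text \<open>Edges are kept in both orientations, as in \<open>pair_graph\<close>; hence the
  cardinalities of edge sets below count every edge twice.\<close>

definition simple_on :: "'v set \<Rightarrow> ('v \<times> 'v) set \<Rightarrow> bool" where
  "simple_on V F \<longleftrightarrow> F \<subseteq> V \<times> V \<and> sym F \<and> irrefl F"

definition regular_on :: "'v set \<Rightarrow> nat \<Rightarrow> ('v \<times> 'v) set \<Rightarrow> bool" where
  "regular_on V k F \<longleftrightarrow> simple_on V F \<and> (\<forall>w\<in>V. card (F `` {w}) = k)"

definition edge :: "'v \<Rightarrow> 'v \<Rightarrow> ('v \<times> 'v) set" where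
  "edge x y = {(x, y), (y, x)}"

lemma simple_on_add: "simple_on V F \<Longrightarrow> x \<in> V \<Longrightarrow> y \<in> V \<Longrightarrow> x \<noteq> y \<Longrightarrow> simple_on V (F \<union> edge x y)"
  by (auto simp: simple_on_def edge_def sym_def irrefl_def)

lemma simple_on_remove: "simple_on V F \<Longrightarrow> simple_on V (F - edge x y)"
  by (auto simp: simple_on_def edge_def sym_def irrefl_def)

lemma finite_Image_simple_on: "finite V \<Longrightarrow> simple_on V F \<Longrightarrow> finite (F `` A)"
  by (rule finite_subset[of _ V]) (auto simp: simple_on_def)

lemma finite_simple_on: "finite V \<Longrightarrow> simple_on V F \<Longrightarrow> finite F"
  by (rule finite_subset[of _ "V \<times> V"]) (auto simp: simple_on_def)

lemma degree_add:
  assumes "finite V" "simple_on V F" "x \<noteq> y" "(x, y) \<notin> F"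
  shows "int (card ((F \<union> edge x y) `` {w})) = int (card (F `` {w})) + of_bool (w = x) + of_bool (w = y)"
proof -
  have yx: "(y, x) \<notin> F"
    using assms by (auto simp: simple_on_def sym_def)
  have fin: "finite (F `` {w})"
    using assms finite_Image_simple_on by blast
  consider "w = x" | "w = y" | "w \<noteq> x" "w \<noteq> y" by blast
  then show ?thesis
  proof cases
    case 1
    then have "(F \<union> edge x y) `` {w} = insert y (F `` {w})"
      using assms by (auto simp: edge_def)
    then show ?thesis using 1 assms fin by simp
  next
    case 2
    then have "(F \<union> edge x y) `` {w} = insert x (F `` {w})"
      using assms by (auto simp: edge_def)
    then show ?thesis using 2 assms yx fin by simp
  next
    case 3
    then have "(F \<union> edge x y) `` {w} = F `` {w}"
      by (auto simp: edge_def)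
    then show ?thesis using 3 by simp
  qed
qed

lemma degree_remove:
  assumes "finite V" "simple_on V F" "(x, y) \<in> F"
  shows "int (card ((F - edge x y) `` {w})) = int (card (F `` {w})) - of_bool (w = x) - of_bool (w = y)"
proof -
  have *: "x \<in> V" "y \<in> V" "x \<noteq> y" "(y, x) \<in> F"
    using assms by (auto simp: simple_on_def irrefl_def sym_def)
  then have "F - edge x y \<union> edge x y = F"
    using assms by (auto simp: edge_def)
  then show ?thesis
    using degree_add[OF assms(1) simple_on_remove[OF assms(2)] *(3), of x y w] by (simp add: edge_def)
qed

text \<open>The hypotheses make the four vertices distinct, and each of them loses one edge and
  gains one.\<close>

lemma switch4:
  assumes V: "finite V" and F: "regular_on V k F"
    and uv: "(u, v) \<in> F" and xy: "(x, y) \<in> F"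
    and new: "(u, x) \<notin> F" "(v, y) \<notin> F" "u \<noteq> x" "v \<noteq> y"
  shows "regular_on V k (F - edge u v - edge x y \<union> edge u x \<union> edge v y)"
proof -
  let ?F1 = "F - edge u v" let ?F2 = "?F1 - edge x y" let ?F3 = "?F2 \<union> edge u x"
  have s: "simple_on V F" and k: "\<And>w. w \<in> V \<Longrightarrow> card (F `` {w}) = k"
    using F by (auto simp: regular_on_def)
  have mem: "u \<in> V" "v \<in> V" "x \<in> V" "y \<in> V" "u \<noteq> v" "x \<noteq> y" "(x, u) \<notin> F" "(y, v) \<notin> F" "(v, u) \<in> F"
    using s uv xy new by (auto simp: simple_on_def sym_def irrefl_def)
  have s1: "simple_on V ?F1" and s2: "simple_on V ?F2"
    using s by (auto intro: simple_on_remove)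
  have s3: "simple_on V ?F3" and s4: "simple_on V (?F3 \<union> edge v y)"
    using s2 mem new by (auto intro!: simple_on_add)
  have "int (card ((?F3 \<union> edge v y) `` {w})) = int (card (F `` {w}))" for w
    using degree_remove[OF V s uv, of w] degree_remove[OF V s1, of x y w]
      degree_add[OF V s2, of u x w] degree_add[OF V s3, of v y w] mem new uv xy
    by (auto simp: edge_def)
  then show ?thesis
    using s4 k by (simp add: regular_on_def)
qed

text \<open>Vertices of the trail may coincide. The side conditions keep its six edges distinct, so
  every removal and insertion takes effect and the degree changes cancel at each vertex.\<close>

lemma switch6:
  assumes V: "finite V" and F: "regular_on V k F"
    and old: "(u, v) \<in> F" "(x, x') \<in> F" "(y, y') \<in> F"
    and new: "(u, x) \<notin> F" "(v, y) \<notin> F" "(x', y') \<notin> F" "u \<noteq> x" "v \<noteq> y" "x' \<noteq> y'"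
    and "(x, y) \<notin> F" "x' \<noteq> v" "y' \<noteq> u"
  shows "regular_on V k (F - edge u v - edge x x' - edge y y' \<union> edge u x \<union> edge v y \<union> edge x' y')"
proof -
  let ?F1 = "F - edge u v" let ?F2 = "?F1 - edge x x'" let ?F3 = "?F2 - edge y y'"
  let ?F4 = "?F3 \<union> edge u x" let ?F5 = "?F4 \<union> edge v y"
  have s: "simple_on V F" and k: "\<And>w. w \<in> V \<Longrightarrow> card (F `` {w}) = k"
    using F by (auto simp: regular_on_def)
  then have sym: "(p, q) \<in> F \<longleftrightarrow> (q, p) \<in> F" for p q
    by (auto simp: simple_on_def sym_def)
  have mem: "u \<in> V" "v \<in> V" "x \<in> V" "y \<in> V" "x' \<in> V" "y' \<in> V" "u \<noteq> v"
    using s old by (auto simp: simple_on_def irrefl_def)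
  have ne: "x' \<noteq> u" "y' \<noteq> v" "\<not> (x = y' \<and> x' = y)" "\<not> (u = y \<and> x = v)"
    using old new \<open>(x, y) \<notin> F\<close> sym by metis+
  have s1: "simple_on V ?F1" and s2: "simple_on V ?F2" and s3: "simple_on V ?F3"
    using s by (auto intro: simple_on_remove)
  have s4: "simple_on V ?F4"
    using s3 mem new by (auto intro!: simple_on_add)
  have s5: "simple_on V ?F5"
    using s4 mem new by (auto intro!: simple_on_add)
  have s6: "simple_on V (?F5 \<union> edge x' y')"
    using s5 mem new by (auto intro!: simple_on_add)
  have "(x, x') \<in> ?F1" "(y, y') \<in> ?F2" "(u, x) \<notin> ?F3" "(v, y) \<notin> ?F4" "(x', y') \<notin> ?F5"
    using old new ne assms(12-14) mem by (auto simp: edge_def)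
  then have "int (card ((?F5 \<union> edge x' y') `` {w})) = int (card (F `` {w}))" for w
    using degree_remove[OF V s old(1), of w] degree_remove[OF V s1, of x x' w]
      degree_remove[OF V s2, of y y' w] degree_add[OF V s3 \<open>u \<noteq> x\<close>, of w]
      degree_add[OF V s4 \<open>v \<noteq> y\<close>, of w] degree_add[OF V s5 \<open>x' \<noteq> y'\<close>, of w]
    by simp
  then show ?thesis
    using s6 k by (simp add: regular_on_def)
qed

text \<open>Serves the parity of \<open>rest\<close>: the two orientations of a pair are removed
  together.\<close>

lemma even_card_symmetric:
  assumes "finite R" "sym R" "irrefl R"
  shows "even (card R)"
  using assms
proof (induction R rule: finite_psubset_induct)
  case (psubset R)
  show ?case
  proof (cases "R = {}")
    case False
    then obtain x y where xy: "(x, y) \<in> R" by auto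
    then have yx: "(y, x) \<in> R" "x \<noteq> y"
      using psubset.prems by (auto simp: sym_def irrefl_def)
    have "even (card (R - edge x y))"
      using psubset.prems xy by (intro psubset.IH) (auto simp: edge_def sym_def irrefl_def)
    moreover have "card (R - edge x y) + 2 = card R"
    proof -
      have "edge x y \<subseteq> R" "card (edge x y) = 2"
        using xy yx by (auto simp: edge_def)
      then show ?thesis
        using card_Diff_subset[of "edge x y" R] card_mono[of R "edge x y"] psubset.hyps
        by (metis finite_subset le_add_diff_inverse2)
    qed
    ultimately show ?thesis by (metis even_add even_numeral)
  qed simp
qed

section \<open>Double counting and complements\<close>

lemma card_relation:
  assumes "finite A" "\<And>x. x \<in> A \<Longrightarrow> finite (R `` {x})"
  shows "card (R \<inter> A \<times> UNIV) = (\<Sum>x\<in>A. card (R `` {x}))"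
proof -
  have "R \<inter> A \<times> UNIV = (SIGMA x:A. R `` {x})" by auto
  then show ?thesis using assms by (simp add: card_SigmaI)
qed

lemma card_relation_le:
  assumes "finite A" "\<And>x. x \<in> A \<Longrightarrow> finite (R `` {x})" "\<And>x. x \<in> A \<Longrightarrow> card (R `` {x}) \<le> k"
  shows "card (R \<inter> A \<times> UNIV) \<le> k * card A"
  using sum_bounded_above[of A "\<lambda>x. card (R `` {x})" k] assms by (simp add: card_relation mult.commute)

definition complement_on :: "'v set \<Rightarrow> ('v \<times> 'v) set \<Rightarrow> ('v \<times> 'v) set" where
  "complement_on V E = {(x, y) \<in> V \<times> V. x \<noteq> y \<and> (x, y) \<notin> E}"

lemma simple_on_complement: "simple_on V E \<Longrightarrow> simple_on V (complement_on V E)"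
  by (auto simp: simple_on_def complement_on_def sym_def irrefl_def)

lemma card_complement_Image:
  assumes "finite V" "simple_on V E" "w \<in> V"
  shows "card (E `` {w}) + card (complement_on V E `` {w}) + 1 = card V"
proof -
  have "V = insert w (E `` {w} \<union> complement_on V E `` {w})"
    using assms by (auto simp: complement_on_def simple_on_def)
  moreover have "w \<notin> E `` {w} \<union> complement_on V E `` {w}" "E `` {w} \<inter> complement_on V E `` {w} = {}"
    using assms by (auto simp: complement_on_def simple_on_def irrefl_def)
  moreover have "finite (E `` {w})" "finite (complement_on V E `` {w})"
    using assms simple_on_complement finite_Image_simple_on by blast+
  ultimately show ?thesis
    by (metis Suc_eq_plus1 card_Un_disjoint card_insert_disjoint finite_UnI)
qed

section \<open>A regular graph with the fewest edges outside a given graph\<close>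

locale minimal_regular =
  fixes V :: "'v set" and E F C :: "('v \<times> 'v) set" and k :: nat
  assumes V: "finite V" and E: "simple_on V E" and C: "C = complement_on V E"
    and F: "regular_on V k F"
    and minimal: "\<And>F'. regular_on V k F' \<Longrightarrow> card (F \<inter> C) \<le> card (F' \<inter> C)"
begin

text \<open>The edges from \<open>u\<close> to \<open>gap u\<close> can enter \<open>F\<close>
  without creating a bad edge.\<close>

definition gap :: "'v \<Rightarrow> 'v set" where "gap u = E `` {u} - F `` {u}"

text \<open>The candidates for \<open>x'\<close> in a trail of length 6 through \<open>u v\<close>;
  \<open>v\<close> is excluded as \<open>switch6\<close> requires.\<close>

definition reach :: "'v \<Rightarrow> 'v \<Rightarrow> 'v set" where "reach u v = F `` gap u - {v}"

definition rest :: "'v \<Rightarrow> 'v \<Rightarrow> ('v \<times> 'v) set" where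
  "rest u v = C \<inter> (V - {u, v}) \<times> (V - {u, v})"

lemma simple_F: "simple_on V F" and degree_F: "w \<in> V \<Longrightarrow> card (F `` {w}) = k"
  using F by (auto simp: regular_on_def)

lemma simple_C: "simple_on V C"
  unfolding C using E by (rule simple_on_complement)

lemma sym_F: "(x, y) \<in> F \<longleftrightarrow> (y, x) \<in> F"
  using simple_F by (auto simp: simple_on_def sym_def)

lemma sym_C: "(x, y) \<in> C \<longleftrightarrow> (y, x) \<in> C"
  using simple_C by (auto simp: simple_on_def sym_def)

lemma mem_V: "(x, y) \<in> F \<Longrightarrow> x \<in> V \<and> y \<in> V \<and> x \<noteq> y" "(x, y) \<in> C \<Longrightarrow> x \<in> V \<and> y \<in> V \<and> x \<noteq> y"
    "(x, y) \<in> E \<Longrightarrow> x \<in> V \<and> y \<in> V \<and> x \<noteq> y"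
  using simple_F simple_C E by (auto simp: simple_on_def irrefl_def)

lemma E_not_C: "(x, y) \<in> E \<Longrightarrow> (x, y) \<notin> C"
  unfolding C by (simp add: complement_on_def)

lemma finite_Image: "finite (F `` A)" "finite (C `` A)" "finite (E `` A)"
  using finite_Image_simple_on V E simple_F simple_C by blast+

lemma finite_C: "finite C" and finite_F: "finite F"
  using V simple_C simple_F finite_simple_on by auto

lemma gap_sub: "gap u \<subseteq> V" and finite_gap: "finite (gap u)" and finite_reach: "finite (reach u v)"
  using mem_V finite_Image by (auto simp: gap_def reach_def)

text \<open>This is how minimality is used: a switch that deletes a bad edge and inserts none would
  lower the count.\<close>

lemma not_improvable:
  assumes "regular_on V k F'" "F' \<inter> C \<subseteq> F \<inter> C" "(u, v) \<in> F \<inter> C" "(u, v) \<notin> F'"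
  shows False
proof -
  have "F' \<inter> C \<subset> F \<inter> C" using assms by blast
  then have "card (F' \<inter> C) < card (F \<inter> C)"
    using finite_C by (intro psubset_card_mono) auto
  with minimal[OF assms(1)] show False by simp
qed

text \<open>Otherwise the 4-cycle \<open>u v y x\<close> could be switched.\<close>

lemma gaps_nonadjacent:
  assumes uv: "(u, v) \<in> F \<inter> C" and x: "x \<in> gap u" and y: "y \<in> gap v"
  shows "(x, y) \<notin> F"
proof
  assume xy: "(x, y) \<in> F"
  have *: "(u, x) \<in> E" "(v, y) \<in> E" "(u, x) \<notin> F" "(v, y) \<notin> F" "(u, v) \<in> F"
    using x y uv by (auto simp: gap_def)
  have n: "(u, x) \<notin> C" "(v, y) \<notin> C" "(x, u) \<notin> C" "(y, v) \<notin> C"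
    using * E_not_C sym_C by blast+
  have d: "u \<noteq> x" "v \<noteq> y" "v \<noteq> x" "u \<noteq> y" "u \<noteq> v" using * mem_V sym_F by blast+
  show False
    by (rule not_improvable[OF switch4[OF V F \<open>(u, v) \<in> F\<close> xy *(3,4) d(1,2)] _ uv])
      (use n d in \<open>auto simp: edge_def\<close>)
qed

text \<open>Otherwise the closed trail \<open>u v y y' x' x\<close> could be switched; here \<open>x = y\<close> is possible.\<close>

lemma reaches_adjacent:
  assumes uv: "(u, v) \<in> F \<inter> C" and x': "x' \<in> reach u v" and y': "y' \<in> reach v u" and ne: "x' \<noteq> y'"
  shows "(x', y') \<in> F \<union> C"
proof (rule ccontr)
  assume not: "(x', y') \<notin> F \<union> C"
  obtain x y where x: "x \<in> gap u" "(x, x') \<in> F" "x' \<noteq> v" and y: "y \<in> gap v" "(y, y') \<in> F" "y' \<noteq> u"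
    using x' y' by (auto simp: reach_def)
  have *: "(u, x) \<in> E" "(v, y) \<in> E" "(u, x) \<notin> F" "(v, y) \<notin> F" "(u, v) \<in> F" "(x, y) \<notin> F" "(x', y') \<notin> F"
    using x y uv not gaps_nonadjacent[OF uv] by (auto simp: gap_def)
  have n: "(u, x) \<notin> C" "(v, y) \<notin> C" "(x, u) \<notin> C" "(y, v) \<notin> C" "(x', y') \<notin> C" "(y', x') \<notin> C"
    using * E_not_C sym_C not by blast+
  have d: "u \<noteq> x" "v \<noteq> y" "v \<noteq> x" "u \<noteq> y" "u \<noteq> v" "u \<noteq> x'" "v \<noteq> y'"
    using * x(2) y(2) mem_V sym_F by blast+
  show False
    by (rule not_improvable[OF switch6[OF V F \<open>(u, v) \<in> F\<close> x(2) y(2) *(3,4) *(7) d(1,2) ne *(6) x(3) y(3)] _ uv])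
      (use n d x(3) y(3) in \<open>auto simp: edge_def\<close>)
qed

text \<open>\<open>v\<close> is one of the \<open>k\<close> neighbours of \<open>u\<close> in
  \<open>F\<close> but not a neighbour in \<open>E\<close>, so \<open>F\<close> occupies at most
  \<open>k - 1\<close> of the edges of \<open>E\<close> at \<open>u\<close>.\<close>

lemma card_gap:
  assumes uv: "(u, v) \<in> F \<inter> C"
  shows "card (E `` {u}) + 1 \<le> card (gap u) + k"
proof -
  have u: "u \<in> V" and v: "v \<in> F `` {u}" "v \<notin> E `` {u}"
    using uv mem_V E_not_C by auto
  have "card (E `` {u} \<inter> F `` {u}) < card (F `` {u})"
    using v finite_Image by (intro psubset_card_mono) auto
  moreover have "card (E `` {u}) = card (gap u) + card (E `` {u} \<inter> F `` {u})"
    unfolding gap_def using finite_Image by (metis card_Diff_subset_Int card_mono finite_Int inf_le1 le_add_diff_inverse2)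
  ultimately show ?thesis
    using degree_F[OF u] by simp
qed

text \<open>Double counting of the \<open>F\<close>-edges at \<open>gap u\<close>: they all end outside \<open>gap v \<union> {u}\<close>.\<close>

lemma card_gaps:
  assumes uv: "(u, v) \<in> F \<inter> C" and k: "1 \<le> k"
  shows "card (gap u) + card (gap v) + 1 \<le> card V"
proof -
  let ?W = "V - gap v - {u}"
  have "k * card (gap u) = card (F \<inter> gap u \<times> UNIV)"
    using finite_gap finite_Image gap_sub degree_F by (subst card_relation) (auto simp: subset_iff)
  also have "\<dots> = card ((F \<inter> gap u \<times> UNIV)\<inverse>)"
    by simp
  also have "\<dots> \<le> card (F \<inter> ?W \<times> UNIV)"
  proof (rule card_mono)
    show "finite (F \<inter> ?W \<times> UNIV)"
      using finite_F by simp
    show "(F \<inter> gap u \<times> UNIV)\<inverse> \<subseteq> F \<inter> ?W \<times> UNIV"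
    proof (rule subrelI)
      fix y x assume "(y, x) \<in> (F \<inter> gap u \<times> UNIV)\<inverse>"
      then have *: "(x, y) \<in> F" "(y, x) \<in> F" "x \<in> gap u" using sym_F by blast+
      then have "y \<in> V" "y \<notin> gap v" "y \<noteq> u"
        using mem_V(1) gaps_nonadjacent[OF uv] unfolding gap_def by blast+
      with * show "(y, x) \<in> F \<inter> ?W \<times> UNIV" by simp
    qed
  qed
  also have "\<dots> \<le> k * card ?W"
    using V finite_Image degree_F by (intro card_relation_le) auto
  finally have "card (gap u) \<le> card ?W"
    using k by simp
  moreover have "card ?W + card (gap v) + 1 = card V"
  proof -
    have "u \<in> V - gap v"
      using uv sym_F[of u v] mem_V(1)[of u v] by (auto simp: gap_def)
    then have "card (V - gap v) = card ?W + 1"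
      using V by (metis Suc_eq_plus1 card_Suc_Diff1 finite_Diff)
    moreover have "card (V - gap v) + card (gap v) = card V"
      using V gap_sub finite_gap by (simp add: card_Diff_subset card_mono)
    ultimately show ?thesis by simp
  qed
  ultimately show ?thesis by simp
qed

text \<open>The \<open>k * card (gap u)\<close> pairs of \<open>F\<close> leaving
  \<open>gap u\<close> end in \<open>reach u v\<close> or at \<open>v\<close>. Each vertex receives
  at most \<open>k\<close> of them, and \<open>v\<close> at most \<open>k - 1\<close>, since its
  neighbour \<open>u\<close> is not in \<open>gap u\<close>. The surplus \<open>k - 1\<close>
  vanishes in the division by \<open>k\<close>.\<close>

lemma card_reach:
  assumes uv: "(u, v) \<in> F \<inter> C" and k: "1 \<le> k"
  shows "card (gap u) \<le> card (reach u v)"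
proof -
  have v: "v \<in> V" "u \<in> F `` {v}" "u \<notin> gap u"
    using uv mem_V(1)[of u v] mem_V(3)[of u u] sym_F[of u v] by (auto simp: gap_def)
  have "k * card (gap u) = card (F \<inter> gap u \<times> UNIV)"
    using finite_gap finite_Image gap_sub degree_F by (subst card_relation) (auto simp: subset_iff)
  also have "\<dots> = card ((F \<inter> gap u \<times> UNIV)\<inverse>)"
    by simp
  also have "\<dots> \<le> card (F \<inter> reach u v \<times> UNIV \<union> {v} \<times> (F `` {v} - {u}))"
  proof (rule card_mono)
    show "finite (F \<inter> reach u v \<times> UNIV \<union> {v} \<times> (F `` {v} - {u}))"
      using finite_F finite_Image by simp
    show "(F \<inter> gap u \<times> UNIV)\<inverse> \<subseteq> F \<inter> reach u v \<times> UNIV \<union> {v} \<times> (F `` {v} - {u})"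
      using v sym_F by (auto simp: reach_def)
  qed
  also have "\<dots> \<le> card (F \<inter> reach u v \<times> UNIV) + card ({v} \<times> (F `` {v} - {u}))"
    by (rule card_Un_le)
  also have "card (F \<inter> reach u v \<times> UNIV) \<le> k * card (reach u v)"
    using finite_reach finite_Image degree_F mem_V by (intro card_relation_le) (auto simp: reach_def)
  also have "card ({v} \<times> (F `` {v} - {u})) = k - 1"
    using v degree_F finite_Image by (simp add: card_cartesian_product)
  finally have "k * card (gap u) < k * (card (reach u v) + 1)"
    using k by simp
  then show ?thesis
    by (simp only: mult_less_cancel1) simp
qed

text \<open>By \<open>reaches_adjacent\<close>, every other vertex of \<open>reach v u\<close> is
  joined to \<open>x'\<close> by a pair of \<open>F\<close> or of \<open>C\<close>. The
  \<open>F\<close>-neighbour \<open>x\<close> through which \<open>x'\<close> was reached lies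
  outside \<open>reach v u\<close>, which makes up for \<open>x'\<close> itself possibly lying
  there.\<close>

lemma card_reach_le:
  assumes uv: "(u, v) \<in> F \<inter> C" and x': "x' \<in> reach u v"
  shows "card (reach v u) \<le> k + card (rest u v `` {x'})"
proof -
  obtain x where x: "x \<in> gap u" "(x, x') \<in> F" "x' \<noteq> v"
    using x' by (auto simp: reach_def)
  \<comment> \<open>\<open>p\<close> is excluded because no vertex of \<open>gap p\<close> is an
    \<open>F\<close>-neighbour of \<open>p\<close>. Hence missing pairs between the two reaches
    belong to \<open>rest\<close>.\<close>
  have sub: "reach p q \<subseteq> V - {p, q}" for p q
    using mem_V(1) sym_F unfolding reach_def gap_def by blast
  have W: "reach u v \<subseteq> V - {u, v}" "reach v u \<subseteq> V - {u, v}"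
    using sub[of u v] sub[of v u] by auto
  have xnot: "x \<notin> reach v u"
    using gaps_nonadjacent[OF uv x(1)] sym_F unfolding reach_def by blast
  have fin: "finite (rest u v `` {x'})"
    by (rule finite_subset[of _ "C `` {x'}"]) (auto simp: rest_def finite_Image)
  have "reach v u \<subseteq> insert x' (F `` {x'} - {x} \<union> rest u v `` {x'})"
    using reaches_adjacent[OF uv x'] xnot W x' unfolding rest_def by blast
  then have "card (reach v u) \<le> card (insert x' (F `` {x'} - {x} \<union> rest u v `` {x'}))"
    using fin finite_Image by (intro card_mono) auto
  also have "\<dots> \<le> Suc (card (F `` {x'} - {x} \<union> rest u v `` {x'}))"
    using fin finite_Image by (simp add: card_insert_if)
  also have "\<dots> \<le> Suc (card (F `` {x'} - {x}) + card (rest u v `` {x'}))"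
    using card_Un_le by simp
  also have "\<dots> = Suc (card (F `` {x'} - {x})) + card (rest u v `` {x'})"
    by simp
  also have "Suc (card (F `` {x'} - {x})) = k"
  proof -
    have "x \<in> F `` {x'}" "x' \<in> V" using x sym_F mem_V(1) by blast+
    then show ?thesis using degree_F finite_Image by (metis card_Suc_Diff1)
  qed
  finally show ?thesis .
qed

section \<open>Counting the missing pairs that avoid a bad edge\<close>

lemma rest_commute: "rest v u = rest u v"
  by (simp add: rest_def insert_commute)

lemma finite_rest: "finite (rest u v)"
  using finite_C by (simp add: rest_def)

lemma even_card_rest: "even (card (rest u v))"
proof (rule even_card_symmetric[OF finite_rest])
  show "sym (rest u v)" "irrefl (rest u v)"
    using simple_C by (auto simp: rest_def simple_on_def sym_def irrefl_def)
qed

text \<open>Each missing pair at \<open>x\<close> occurs in \<open>rest u v\<close> in both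
  orientations.\<close>

lemma rest_degree: "2 * card (rest u v `` {x}) \<le> card (rest u v)"
proof -
  let ?N = "rest u v `` {x}"
  have fin: "finite ?N"
    by (rule finite_subset[of _ "C `` {x}"]) (auto simp: rest_def finite_Image)
  have "{x} \<times> ?N \<inter> ?N \<times> {x} = {}"
    using mem_V by (auto simp: rest_def)
  then have "2 * card ?N = card ({x} \<times> ?N \<union> ?N \<times> {x})"
    using fin by (subst card_Un_disjoint) (auto simp: card_cartesian_product)
  also have "\<dots> \<le> card (rest u v)"
    using finite_rest sym_C by (intro card_mono) (auto simp: rest_def)
  finally show ?thesis .
qed

text \<open>\<open>card_reach_le\<close> is summed over \<open>reach u v\<close>, counting pairs by
  their first entry; where the subtraction truncates, the bound is trivial.\<close>

lemma reach_product:
  assumes uv: "(u, v) \<in> F \<inter> C"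
  shows "card (reach u v) * (card (reach v u) - k) \<le> card (rest u v)"
proof -
  have fin: "finite (rest u v `` {x})" for x
    by (rule finite_subset[of _ "C `` {x}"]) (auto simp: rest_def finite_Image)
  have "card (reach u v) * (card (reach v u) - k) \<le> (\<Sum>x\<in>reach u v. card (rest u v `` {x}))"
    using sum_bounded_below[of "reach u v" "card (reach v u) - k" "\<lambda>x. card (rest u v `` {x})"]
      card_reach_le[OF uv] by force
  also have "\<dots> = card (rest u v \<inter> reach u v \<times> UNIV)"
    using finite_reach fin by (simp add: card_relation)
  also have "\<dots> \<le> card (rest u v)"
    using finite_rest by (intro card_mono) auto
  finally show ?thesis .
qed

text \<open>Among the ordered pairs of \<open>C\<close> meeting \<open>u\<close> or
  \<open>v\<close>, the degrees count only \<open>(u, v)\<close> and \<open>(v, u)\<close> twice,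
  whence the \<open>2\<close>.\<close>

lemma card_rest:
  assumes uv: "(u, v) \<in> C"
  shows "card (rest u v) + 2 * card (C `` {u}) + 2 * card (C `` {v}) \<le> card C + 2"
proof -
  have fin: "finite (C `` {w})" for w by (rule finite_Image)
  have mem: "v \<in> C `` {u}" "u \<in> C `` {v}" "u \<noteq> v" and irr: "(w, w) \<notin> C" for w
    using uv sym_C mem_V by blast+
  let ?U = "{u} \<times> (C `` {u})" and ?V = "{v} \<times> (C `` {v})"
    and ?U' = "(C `` {u} - {v}) \<times> {u}" and ?V' = "(C `` {v} - {u}) \<times> {v}"
  have "card (rest u v \<union> ?U \<union> ?V \<union> ?U' \<union> ?V') = card (rest u v) + card ?U + card ?V + card ?U' + card ?V'"
  proof -
    have "card (rest u v \<union> ?U \<union> ?V \<union> ?U' \<union> ?V') = card (rest u v \<union> ?U \<union> ?V \<union> ?U') + card ?V'"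
      using finite_rest fin mem irr by (intro card_Un_disjoint) (auto simp: rest_def)
    moreover have "card (rest u v \<union> ?U \<union> ?V \<union> ?U') = card (rest u v \<union> ?U \<union> ?V) + card ?U'"
      using finite_rest fin mem irr by (intro card_Un_disjoint) (auto simp: rest_def)
    moreover have "card (rest u v \<union> ?U \<union> ?V) = card (rest u v \<union> ?U) + card ?V"
      using finite_rest fin mem irr by (intro card_Un_disjoint) (auto simp: rest_def)
    moreover have "card (rest u v \<union> ?U) = card (rest u v) + card ?U"
      using finite_rest fin mem irr by (intro card_Un_disjoint) (auto simp: rest_def)
    ultimately show ?thesis by simp
  qed
  moreover have "card (rest u v \<union> ?U \<union> ?V \<union> ?U' \<union> ?V') \<le> card C"
    using finite_C sym_C by (intro card_mono) (auto simp: rest_def)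
  moreover have "card ?U = card (C `` {u})" "card ?V = card (C `` {v})"
    by (simp_all add: card_cartesian_product)
  moreover have "card ?U' + 1 = card (C `` {u})" "card ?V' + 1 = card (C `` {v})"
    using mem fin by (metis Suc_eq_plus1 card_Suc_Diff1 card_cartesian_product card_1_singleton_iff mult.right_neutral One_nat_def)+
  ultimately show ?thesis by linarith
qed

end

text \<open>
  In the application \<open>a, b\<close> are the sizes of the two gaps, \<open>p, q\<close> those of the two reaches, and
  \<open>r\<close> counts the ordered bad pairs avoiding \<open>u\<close> and \<open>v\<close>. The parity of \<open>r\<close> matters only for \<open>k = 2\<close>, \<open>n = 7\<close>.
\<close>

lemma counting_contradiction:
  fixes a b p q k n r :: int
  assumes k: "1 \<le> k" "4 * k \<le> n + 1" "k = 1 \<Longrightarrow> 4 \<le> n"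
    and ab: "a + b + 1 \<le> n" "a \<le> p" "b \<le> q"
    and r: "r + 2 * n + 1 \<le> 2 * a + 2 * b + 3 * k"
    and evenr: "even r"
    and deg: "2 * q \<le> r + 2 * k" "2 * p \<le> r + 2 * k"
    and prod: "p * (q - k) \<le> r" "q * (p - k) \<le> r"
  shows False
proof -
  \<comment> \<open>The situation is symmetric in \<open>p\<close> and \<open>q\<close>, so it
    suffices to treat \<open>p \<le> q\<close>.\<close>
  have *: False if "p \<le> q" "p * (q - k) \<le> r" "2 * q \<le> r + 2 * k" "2 * p \<le> r + 2 * k"
      "a + b \<le> p + q" for p q
  proof -
    \<comment> \<open>For \<open>k = 1\<close>, the bound on \<open>a + b\<close> forces
      \<open>r \<le> 0\<close>, and the degree bounds then give \<open>2 * n \<le> r + 6\<close>,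
      against \<open>4 \<le> n\<close>.\<close>
    have k2: "k \<ge> 2"
    proof (rule ccontr)
      assume "\<not> k \<ge> 2"
      with k have "k = 1" "4 \<le> n" by auto
      with that(3-5) ab(1) r show False by linarith
    qed
    \<comment> \<open>Bounding \<open>q\<close> by \<open>2 * q \<le> r + 2 * k\<close> cancels
      \<open>r\<close> and leaves \<open>2 * p \<ge> 2 * n + 1 - 5 * k\<close>, where
      \<open>n \<ge> 4 * k - 1\<close>.\<close>
    have p: "2 * p \<ge> 3 * k - 1"
      using that(3,5) k(2) r by linarith
    have q: "4 * q \<ge> r + 5 * k - 1"
      using that(1,5) k(2) r by linarith
    have r0: "r \<le> 3 * k - 3" using ab(1) r by linarith
    have p0: "p \<ge> 3" using p k2 by linarith
    define d where "d = q - k"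
    have qd: "q = k + d" and pd: "p * d \<le> r"
      using that(2) by (simp_all add: d_def)
    have d: "d \<ge> 1" using p k2 that(1) qd by linarith
    show False
    proof (cases "k = 2")
      case True
      have "3 * d \<le> p * d"
        using p0 d by (intro mult_right_mono) auto
      \<comment> \<open>Here \<open>r0\<close> gives only \<open>r \<le> 3\<close>, which would
        still allow \<open>p = 3\<close>, \<open>d = 1\<close>; evenness excludes it.\<close>
      moreover have "r \<le> 2"
        using r0 True evenr by presburger
      ultimately show False using pd d by linarith
    next
      case False
      then have "p \<ge> 4" using p k2 by linarith
      then have "4 * d \<le> p * d"
        using d by (intro mult_right_mono) auto
      \<comment> \<open>In terms of \<open>d\<close>, the bound \<open>q\<close> reads
        \<open>4 * d \<ge> r + k - 1\<close>, which exceeds \<open>r\<close>.\<close>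
      then show False using q qd k2 pd by linarith
    qed
  qed
  show False
    using *[of p q] *[of q p] ab(2,3) deg prod by linarith
qed

context minimal_regular
begin

lemma no_bad_edge:
  assumes k: "1 \<le> k" "4 * k \<le> card V + 1" "k = 1 \<Longrightarrow> 4 \<le> card V"
    and mindeg: "\<And>w. w \<in> V \<Longrightarrow> k \<le> card (E `` {w})"
    and sparse: "card C + 3 + k \<le> 2 * card V"
  shows "F \<inter> C = {}"
proof (rule ccontr)
  assume "F \<inter> C \<noteq> {}"
  then obtain u v where uv: "(u, v) \<in> F \<inter> C" by auto
  then have vu: "(v, u) \<in> F \<inter> C" and mem: "u \<in> V" "v \<in> V"
    using sym_F sym_C mem_V(1) by blast+
  note gap_u = card_gap[OF uv] and gap_v = card_gap[OF vu]
  note Cu = card_complement_Image[OF V E mem(1), folded C]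
  note Cv = card_complement_Image[OF V E mem(2), folded C]
  note reach_u = card_reach[OF uv k(1)] and reach_v = card_reach[OF vu k(1)]
  \<comment> \<open>Minimum degree \<open>k\<close> and \<open>card_gap\<close> make both gaps
    nonempty, hence both reaches.\<close>
  have "0 < card (reach u v)" "0 < card (reach v u)"
    using gap_u gap_v mindeg mem reach_u reach_v by fastforce+
  then obtain x y where x: "x \<in> reach u v" and y: "y \<in> reach v u"
    by (metis card_gt_0_iff equals0I)
  note deg = card_reach_le[OF uv x] card_reach_le[OF vu y] rest_degree[of u v x] rest_degree[of v u y]
  have int_le: "int c * (int d - int l) \<le> int m" if "c * (d - l) \<le> m" for c d l m :: nat
  proof -
    have "int c * (int d - int l) \<le> int c * int (d - l)"
      by (intro mult_left_mono) auto
    also have "\<dots> \<le> int m" using that by (metis of_nat_le_iff of_nat_mult)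
    finally show ?thesis .
  qed
  show False
  proof (rule counting_contradiction[of "int k" "int (card V)" "int (card (gap u))" "int (card (gap v))"
        "int (card (reach u v))" "int (card (reach v u))" "int (card (rest u v))"])
    show "int (card (reach u v)) * (int (card (reach v u)) - int k) \<le> int (card (rest u v))"
      using reach_product[OF uv] by (rule int_le)
    show "int (card (reach v u)) * (int (card (reach u v)) - int k) \<le> int (card (rest u v))"
      using reach_product[OF vu] unfolding rest_commute[of v u] by (rule int_le)
    \<comment> \<open>By \<open>card_gap\<close>, the complement degree of \<open>u\<close> is at
      least \<open>card V - k - card (gap u)\<close>, and likewise at \<open>v\<close>; with
      \<open>sparse\<close>, these enter \<open>card_rest\<close>.\<close>
    show "int (card (rest u v)) + 2 * int (card V) + 1 \<le> 2 * int (card (gap u)) + 2 * int (card (gap v)) + 3 * int k"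
      using card_rest[of u v] uv sparse gap_u gap_v Cu Cv by simp
    show "2 * int (card (reach v u)) \<le> int (card (rest u v)) + 2 * int k"
      "2 * int (card (reach u v)) \<le> int (card (rest u v)) + 2 * int k"
      using deg unfolding rest_commute[of v u] by linarith+
  qed (use k card_gaps[OF uv k(1)] reach_u reach_v even_card_rest in auto)
qed

end

section \<open>Existence of regular graphs and of regular factors\<close>

text \<open>This is the circulant graph with connection set \<open>D\<close>: as \<open>D\<close> is
  closed under negation modulo \<open>n\<close>, the neighbours of \<open>i\<close> are the residues
  of \<open>i + d\<close> for \<open>d\<close> in \<open>D\<close>.\<close>

lemma circulant_regular:
  fixes n :: nat
  assumes D: "D \<subseteq> {1..<n}" "\<And>d. d \<in> D \<Longrightarrow> n - d \<in> D"
  shows "regular_on {0..<n} (card D)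
    {(i, j). i < n \<and> j < n \<and> (i < j \<and> j - i \<in> D \<or> j < i \<and> i - j \<in> D)}" (is "regular_on _ _ ?F")
  unfolding regular_on_def
proof (intro conjI ballI)
  show "simple_on {0..<n} ?F"
    by (auto simp: simple_on_def sym_def irrefl_def)
  fix i assume "i \<in> {0..<n}"
  then have i: "i < n" by simp
  let ?f = "\<lambda>d. if i + d < n then i + d else i + d - n"
  have "?F `` {i} = ?f ` D"
  proof (intro equalityI subsetI)
    fix j assume "j \<in> ?F `` {i}"
    then consider "i < j" "j < n" "j - i \<in> D" | "j < i" "i - j \<in> D" by auto
    then show "j \<in> ?f ` D"
    proof cases
      case 1
      then show ?thesis by (intro image_eqI[of _ _ "j - i"]) auto
    next
      case 2
      then show ?thesis using i D(2)[of "i - j"] by (intro image_eqI[of _ _ "n - (i - j)"]) auto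
    qed
  next
    fix j assume "j \<in> ?f ` D"
    then obtain d where d: "d \<in> D" "j = ?f d" by auto
    then have "1 \<le> d" "d < n" using D(1) by auto
    moreover have "i - (i + d - n) = n - d" if "\<not> i + d < n" using that \<open>d < n\<close> by linarith
    ultimately show "j \<in> ?F `` {i}"
      using i d D(2)[of d] by (cases "i + d < n") auto
  qed
  moreover have "inj_on ?f D"
  proof (rule inj_onI)
    fix c d assume "c \<in> D" "d \<in> D" "?f c = ?f d"
    moreover from this D(1) have "c < n" "d < n" by auto
    ultimately show "c = d" using i by (auto split: if_splits)
  qed
  ultimately show "card (?F `` {i}) = card D"
    by (metis card_image)
qed

lemma regular_on_image:
  assumes F: "regular_on U k F" and h: "inj_on h U"
  shows "regular_on (h ` U) k (map_prod h h ` F)"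
  unfolding regular_on_def
proof (intro conjI ballI)
  have s: "simple_on U F" using F by (simp add: regular_on_def)
  then show "simple_on (h ` U) (map_prod h h ` F)"
    using h unfolding simple_on_def sym_def irrefl_def inj_on_def by fastforce
  fix w assume "w \<in> h ` U"
  then obtain i where i: "w = h i" "i \<in> U" by auto
  have "(map_prod h h ` F) `` {w} = h ` (F `` {i})"
    using s h i by (auto simp: simple_on_def inj_on_def)
  moreover have "inj_on h (F `` {i})"
    using h by (rule inj_on_subset) (use s in \<open>auto simp: simple_on_def\<close>)
  ultimately show "card ((map_prod h h ` F) `` {w}) = k"
    using F i by (simp add: card_image regular_on_def)
qed

text \<open>A circulant graph is transported to \<open>V\<close>. For even \<open>k\<close> its
  connection set consists of the \<open>k div 2\<close> smallest distances and their negatives; for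
  odd \<open>k\<close>, \<open>n\<close> is even and the self-inverse distance \<open>n / 2\<close>
  is added.\<close>

lemma ex_regular_on:
  assumes V: "finite V" and k: "k < card V" "even (k * card V)"
  shows "\<exists>F. regular_on V k F"
proof -
  define n m where "n = card V" and "m = k div 2"
  have "\<exists>D. D \<subseteq> {1..<n} \<and> (\<forall>d\<in>D. n - d \<in> D) \<and> card D = k"
  proof (cases "even k")
    case True
    then have "k = 2 * m" "2 * m < n" using k by (auto simp: m_def n_def)
    moreover from this have "card ({1..m} \<union> {n - m..<n}) = card {1..m} + card {n - m..<n}"
      by (intro card_Un_disjoint) auto
    ultimately show ?thesis
      by (intro exI[of _ "{1..m} \<union> {n - m..<n}"]) auto
  next
    case False
    then have *: "k = 2 * m + 1" "even n" "2 * m + 1 < n" using k by (auto simp: m_def n_def)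
    then obtain l where l: "n = 2 * l" by auto
    have "card (insert l ({1..m} \<union> {n - m..<n})) = Suc (card ({1..m} \<union> {n - m..<n}))"
      using * l by (intro card_insert_disjoint) auto
    also have "card ({1..m} \<union> {n - m..<n}) = card {1..m} + card {n - m..<n}"
      using * by (intro card_Un_disjoint) auto
    finally show ?thesis
      using * l by (intro exI[of _ "insert l ({1..m} \<union> {n - m..<n})"]) auto
  qed
  then obtain D where "D \<subseteq> {1..<n}" "\<And>d. d \<in> D \<Longrightarrow> n - d \<in> D" "card D = k" by auto
  then obtain F where F: "regular_on {0..<n} k F"
    using circulant_regular by blast
  obtain h where h: "bij_betw h {0..<n} V"
    using V ex_bij_betw_nat_finite n_def by blast
  then show ?thesis
    using regular_on_image[OF F, of h] by (auto simp: bij_betw_def)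
qed

lemma ex_regular_factor:
  assumes V: "finite V" and E: "simple_on V E"
    and k: "1 \<le> k" "4 * k \<le> card V + 1" "even (k * card V)"
    and mindeg: "\<And>w. w \<in> V \<Longrightarrow> k \<le> card (E `` {w})"
    and sparse: "card (complement_on V E) + 3 + k \<le> 2 * card V"
  shows "\<exists>F. regular_on V k F \<and> F \<subseteq> E"
proof -
  let ?C = "complement_on V E"
  obtain F0 where "regular_on V k F0"
    using ex_regular_on[OF V _ k(3)] k by auto
  then obtain F where F: "regular_on V k F" "\<And>F'. regular_on V k F' \<Longrightarrow> card (F \<inter> ?C) \<le> card (F' \<inter> ?C)"
    using ex_has_least_nat[of "regular_on V k" F0 "\<lambda>F. card (F \<inter> ?C)"] by blast
  interpret minimal_regular V E F ?C k
    using V E F by unfold_locales auto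
  \<comment> \<open>For \<open>k = 1\<close> the size bound gives only
    \<open>3 \<le> card V\<close>; parity excludes \<open>3\<close>.\<close>
  have "4 \<le> card V" if "k = 1"
    using that k by (cases "card V = 3") auto
  then have "F \<inter> ?C = {}"
    using k mindeg sparse by (intro no_bad_edge) auto
  moreover have "F \<subseteq> V \<times> V" "irrefl F"
    using F(1) by (auto simp: regular_on_def simple_on_def)
  ultimately have "F \<subseteq> E"
    unfolding complement_on_def irrefl_def by blast
  with F(1) show ?thesis by blast
qed

section \<open>Spectral estimates\<close>

text \<open>A complex eigenvalue \<open>c\<close> with eigenvector \<open>w\<close> exists. Symmetry
  makes the form \<open>q\<close> of \<open>w\<close> real, and \<open>q\<close> is \<open>c\<close>
  times the positive number \<open>N\<close>, so \<open>c\<close> is real and a root of the real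
  characteristic polynomial.\<close>

lemma real_symmetric_mat_eigenvalue:
  fixes A :: "real mat"
  assumes A: "A \<in> carrier_mat n n" and n: "0 < n"
    and sym: "\<And>i j. i < n \<Longrightarrow> j < n \<Longrightarrow> A $$ (i, j) = A $$ (j, i)"
  shows "\<exists>k. eigenvalue A k"
proof -
  let ?B = "map_mat complex_of_real A"
  have B: "?B \<in> carrier_mat n n" using A by simp
  obtain c where c: "eigenvalue ?B c"
    using spectrum_non_empty[OF B n] by (auto simp: spectrum_def)
  then obtain w where w: "w \<in> carrier_vec n" "w \<noteq> 0\<^sub>v n" "?B *\<^sub>v w = c \<cdot>\<^sub>v w"
    using A by (auto simp: eigenvalue_def eigenvector_def)
  have row: "(\<Sum>j<n. of_real (A $$ (i, j)) * w $ j) = c * w $ i" if "i < n" for i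
  proof -
    have "(?B *\<^sub>v w) $ i = (\<Sum>j<n. of_real (A $$ (i, j)) * w $ j)"
      using that A w(1) by (auto simp: scalar_prod_def lessThan_atLeast0 intro!: sum.cong)
    then show ?thesis using w that by simp
  qed
  define q where "q = (\<Sum>i<n. \<Sum>j<n. cnj (w $ i) * (of_real (A $$ (i, j)) * w $ j))"
  define N where "N = (\<Sum>i<n. (cmod (w $ i))\<^sup>2)"
  have "q = (\<Sum>i<n. cnj (w $ i) * (c * w $ i))"
    unfolding q_def by (intro sum.cong refl) (simp flip: sum_distrib_left add: row)
  also have "\<dots> = c * of_real N"
    unfolding N_def of_real_sum sum_distrib_left
    by (intro sum.cong refl) (simp add: complex_norm_square mult_ac del: of_real_power)
  finally have q1: "q = c * of_real N" .
  have "cnj q = (\<Sum>i<n. \<Sum>j<n. w $ i * (of_real (A $$ (i, j)) * cnj (w $ j)))"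
    by (simp add: q_def)
  also have "\<dots> = (\<Sum>j<n. \<Sum>i<n. w $ i * (of_real (A $$ (i, j)) * cnj (w $ j)))"
    by (rule sum.swap)
  also have "\<dots> = q"
    unfolding q_def using sym by (intro sum.cong refl) (simp add: mult_ac)
  finally have q2: "cnj q = q" .
  obtain i where "i < n" "w $ i \<noteq> 0"
    using w(1,2) by (auto simp: vec_eq_iff)
  then have "0 < N"
    unfolding N_def by (intro sum_pos2[of _ i]) auto
  with q1 q2 have "cnj c = c" by simp
  then have "c = of_real (Re c)"
    by (metis Reals_cnj_iff of_real_Re)
  then have "poly (char_poly ?B) (of_real (Re c)) = 0"
    using c eigenvalue_root_char_poly[OF B] by metis
  then have "poly (char_poly A) (Re c) = 0"
    unfolding of_real_hom.char_poly_hom[OF A] by (simp add: of_real_hom.poly_map_poly)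
  then show ?thesis
    using eigenvalue_root_char_poly[OF A] by blast
qed

section \<open>Eigenvalues of graphs through neighbour sums\<close>

lemma eigenvalue_adjacency_matrix_iff:
  assumes G: "pair_graph G"
  shows "k \<in> spectrum (adjacency_matrix G) \<longleftrightarrow>
    (\<exists>x. (\<exists>u \<in> pverts G. x u \<noteq> 0) \<and>
         (\<forall>u \<in> pverts G. (\<Sum>v \<in> parcs G `` {u}. x v) = k * x u))"
proof -
  have fin: "finite (pverts G)" and sub: "parcs G \<subseteq> pverts G \<times> pverts G"
    using pair_graphD[OF G] by auto
  obtain vs where vs: "distinct vs" "set vs = pverts G"
    using finite_distinct_list[OF fin] by auto
  have "(\<Sum>v \<in> pverts G. (if (u, v) \<in> parcs G then 1 else 0) * x v) = (\<Sum>v \<in> parcs G `` {u}. x v)"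
    for u and x :: "_ \<Rightarrow> real"
  proof -
    have "(\<Sum>v \<in> pverts G. (if (u, v) \<in> parcs G then 1 else 0) * x v)
        = (\<Sum>v \<in> pverts G. if (u, v) \<in> parcs G then x v else 0)"
      by (intro sum.cong) auto
    also have "\<dots> = (\<Sum>v | v \<in> pverts G \<and> (u, v) \<in> parcs G. x v)"
      using fin by (simp add: sum.inter_filter)
    also have "{v. v \<in> pverts G \<and> (u, v) \<in> parcs G} = parcs G `` {u}"
      using sub by auto
    finally show ?thesis .
  qed
  then show ?thesis
    unfolding spectrum_adjacency_matrix_eq[OF vs] unfolding spectrum_def mem_Collect_eq
      eigenvalue_adjacency_matrix_wrt_iff[OF vs(1)] vs(2) by simp
qed

text \<open>Finiteness and nonemptiness of the real spectrum give meaning to the \<open>Max\<close>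
  in \<open>graph_spectral_radius\<close>.\<close>

lemma adjacency_matrix_spectrum:
  assumes G: "pair_graph G" and n: "pverts G \<noteq> {}"
  shows "finite (spectrum (adjacency_matrix G))" "graph_spectral_radius G \<in> spectrum (adjacency_matrix G)"
proof -
  obtain vs where vs: "distinct vs" "set vs = pverts G"
    using finite_distinct_list pair_graphD(1)[OF G] by blast
  let ?A = "adjacency_matrix_wrt vs G"
  have A: "?A \<in> carrier_mat (length vs) (length vs)"
    by (simp add: adjacency_matrix_wrt_def)
  have "\<exists>k. eigenvalue ?A k"
  proof (rule real_symmetric_mat_eigenvalue[OF A])
    show "0 < length vs" using vs n by auto
    show "?A $$ (i, j) = ?A $$ (j, i)" if "i < length vs" "j < length vs" for i j
      using that pair_graphD(3)[OF G] by (auto simp: adjacency_matrix_wrt_def dest: symD)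
  qed
  moreover show fin: "finite (spectrum (adjacency_matrix G))"
    using card_finite_spectrum(1)[OF A] by (simp add: spectrum_adjacency_matrix_eq[OF vs])
  ultimately show "graph_spectral_radius G \<in> spectrum (adjacency_matrix G)"
    unfolding graph_spectral_radius_def
    by (intro Max_in) (auto simp: spectrum_adjacency_matrix_eq[OF vs], auto simp: spectrum_def)
qed

text \<open>For an eigenvector \<open>x\<close> and the symmetric adjacency operator
  \<open>A\<close>, pairing \<open>\<bar>x\<bar>\<close> with \<open>y\<close> gives \<mu> <y, |x|>
  \<le> <y, A|x|> = <Ay, |x|> \<le> l <y, |x|>, and <y, |x|> is positive.\<close>

lemma eigenvalue_le_supersolution:
  assumes G: "pair_graph G" and \<mu>: "\<mu> \<in> spectrum (adjacency_matrix G)"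
    and pos: "\<And>u. u \<in> pverts G \<Longrightarrow> 0 < y u"
    and super: "\<And>u. u \<in> pverts G \<Longrightarrow> (\<Sum>v \<in> parcs G `` {u}. y v) \<le> l * y u"
  shows "\<mu> \<le> l"
proof -
  let ?V = "pverts G" and ?E = "parcs G"
  have fin: "finite ?V" and sub: "?E \<subseteq> ?V \<times> ?V" and sym: "sym ?E"
    using pair_graphD[OF G] by auto
  obtain x where x: "\<exists>u\<in>?V. x u \<noteq> 0" "\<And>u. u \<in> ?V \<Longrightarrow> (\<Sum>v \<in> ?E `` {u}. x v) = \<mu> * x u"
    using \<mu> eigenvalue_adjacency_matrix_iff[OF G] by blast
  have N: "?E `` {u} = {v \<in> ?V. (u, v) \<in> ?E}" for u using sub by auto
  have "\<mu> * (\<Sum>u\<in>?V. y u * \<bar>x u\<bar>) = (\<Sum>u\<in>?V. y u * (\<mu> * \<bar>x u\<bar>))"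
    by (simp add: sum_distrib_left mult_ac)
  also have "\<dots> \<le> (\<Sum>u\<in>?V. y u * (\<Sum>v \<in> ?E `` {u}. \<bar>x v\<bar>))"
  proof (intro sum_mono mult_left_mono)
    fix u assume u: "u \<in> ?V"
    have "\<mu> * \<bar>x u\<bar> \<le> \<bar>\<mu> * x u\<bar>" by (simp add: abs_mult mult_right_mono)
    also have "\<dots> \<le> (\<Sum>v \<in> ?E `` {u}. \<bar>x v\<bar>)"
      using x(2)[OF u] by (metis sum_abs)
    finally show "\<mu> * \<bar>x u\<bar> \<le> (\<Sum>v \<in> ?E `` {u}. \<bar>x v\<bar>)" .
  qed (use pos in \<open>auto intro: less_imp_le\<close>)
  also have "\<dots> = (\<Sum>v\<in>?V. \<Sum>u \<in> ?E `` {v}. y u * \<bar>x v\<bar>)"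
    unfolding sum_distrib_left N using sym fin
    by (subst sum.swap_restrict) (auto intro!: sum.cong dest: symD)
  also have "\<dots> = (\<Sum>v\<in>?V. \<bar>x v\<bar> * (\<Sum>u \<in> ?E `` {v}. y u))"
    by (simp add: sum_distrib_left mult_ac)
  also have "\<dots> \<le> (\<Sum>v\<in>?V. \<bar>x v\<bar> * (l * y v))"
    using super by (intro sum_mono mult_left_mono) auto
  also have "\<dots> = l * (\<Sum>u\<in>?V. y u * \<bar>x u\<bar>)"
    by (simp add: sum_distrib_left mult_ac)
  finally have "\<mu> * (\<Sum>u\<in>?V. y u * \<bar>x u\<bar>) \<le> l * (\<Sum>u\<in>?V. y u * \<bar>x u\<bar>)" .
  moreover have "0 < (\<Sum>u\<in>?V. y u * \<bar>x u\<bar>)"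
  proof -
    obtain u where "u \<in> ?V" "x u \<noteq> 0" using x(1) by auto
    then show ?thesis
      using fin pos by (intro sum_pos2[of _ u]) (auto simp: less_imp_le)
  qed
  ultimately show ?thesis by simp
qed

text \<open>
  For an eigenvector \<open>x\<close>, the vector \<open>y = \<bar>x\<bar>\<close> satisfies \<open>A y \<ge> \<mu> y\<close>, which replaces the nonnegative
  Perron eigenvector; the claim follows by summing the entries of \<open>(A\<^sup>2 - (k - 1) A) y\<close>. Note that
  \<^term>\<open>card (parcs G)\<close> is twice the number of edges.
\<close>

lemma spectral_radius_edge_bound:
  assumes G: "pair_graph G" and \<mu>: "\<mu> \<in> spectrum (adjacency_matrix G)"
    and mindeg: "\<And>u. u \<in> pverts G \<Longrightarrow> k \<le> card (parcs G `` {u})"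
    and k: "1 \<le> k" "real k - 1 \<le> \<mu>"
  shows "\<mu> * (\<mu> - (real k - 1)) \<le> real (card (parcs G)) - (real (card (pverts G)) - 1) * real k"
proof -
  let ?V = "pverts G" and ?E = "parcs G"
  define d where "d u = real (card (?E `` {u}))" for u
  define n where "n = real (card ?V)"
  have fin: "finite ?V" and sub: "?E \<subseteq> ?V \<times> ?V" and sym: "sym ?E" and irr: "irrefl ?E"
    using pair_graphD[OF G] by auto
  obtain x where x: "\<exists>u\<in>?V. x u \<noteq> 0" "\<And>u. u \<in> ?V \<Longrightarrow> (\<Sum>v \<in> ?E `` {u}. x v) = \<mu> * x u"
    using \<mu> eigenvalue_adjacency_matrix_iff[OF G] by blast
  define y where "y u = \<bar>x u\<bar>" for u
  define z where "z u = (\<Sum>v \<in> ?E `` {u}. y v)" for u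
  have N: "?E `` {u} = {v \<in> ?V. (u, v) \<in> ?E}" for u using sub by auto
  have dk: "real k \<le> d u" if "u \<in> ?V" for u
    using mindeg[OF that] by (simp add: d_def)
  have y0: "0 \<le> y u" for u by (simp add: y_def)
  have z: "\<mu> * y u \<le> z u" if "u \<in> ?V" for u
  proof -
    have "\<mu> * y u \<le> \<bar>\<mu> * x u\<bar>" by (simp add: y_def abs_mult mult_right_mono)
    also have "\<dots> \<le> z u"
      using x(2)[OF that] unfolding z_def y_def by (metis sum_abs)
    finally show ?thesis .
  qed
  \<comment> \<open>This is the symmetry of the adjacency operator, used with \<open>f = d\<close>
    and with \<open>f\<close> constantly 1.\<close>
  have swap: "(\<Sum>u\<in>?V. f u * z u) = (\<Sum>v\<in>?V. y v * (\<Sum>u \<in> ?E `` {v}. f u))" for f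
  proof -
    have "(\<Sum>u\<in>?V. f u * z u) = (\<Sum>u\<in>?V. \<Sum>v | v \<in> ?V \<and> (u, v) \<in> ?E. f u * y v)"
      unfolding z_def sum_distrib_left N ..
    also have "\<dots> = (\<Sum>v\<in>?V. \<Sum>u | u \<in> ?V \<and> (u, v) \<in> ?E. f u * y v)"
      using fin by (intro sum.swap_restrict) auto
    also have "\<dots> = (\<Sum>v\<in>?V. y v * (\<Sum>u \<in> ?E `` {v}. f u))"
      unfolding sum_distrib_left N using sym by (intro sum.cong) (auto dest: symD simp: mult.commute)
    finally show ?thesis .
  qed
  have E: "real (card ?E) = (\<Sum>u\<in>?V. d u)"
  proof -
    have "?E = (SIGMA u:?V. ?E `` {u})" using sub by auto
    then have "card ?E = card (SIGMA u:?V. ?E `` {u})" by (rule arg_cong)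
    also have "\<dots> = (\<Sum>u\<in>?V. card (?E `` {u}))"
      using fin by (intro card_SigmaI) (auto simp: N)
    finally show ?thesis by (simp add: d_def)
  qed
  \<comment> \<open>This bounds a row sum: the \<open>n - 1 - d v\<close> vertices that are neither
    \<open>v\<close> nor adjacent to it have degree at least \<open>k\<close>, and the terms in
    \<open>d v\<close> cancel.\<close>
  have nbr: "(\<Sum>u \<in> ?E `` {v}. d u) - (real k - 1) * d v \<le> real (card ?E) - (n - 1) * real k" if v: "v \<in> ?V" for v
  proof -
    let ?R = "?V - {v} - ?E `` {v}"
    have Nv: "?E `` {v} \<subseteq> ?V - {v}" "finite (?E `` {v})"
      using sub irr fin N by (auto simp: irrefl_def)
    have "card ?R + card (?E `` {v}) = card (?V - {v})"
      using Nv fin by (simp add: card_Diff_subset card_mono)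
    moreover have "card (?V - {v}) + 1 = card ?V"
      using v fin by (metis Suc_eq_plus1 card_Suc_Diff1)
    ultimately have "real (card ?R) = n - 1 - d v"
      by (simp add: n_def d_def)
    moreover have "real (card ?R) * real k \<le> (\<Sum>u\<in>?R. d u)"
      using dk by (intro sum_bounded_below) auto
    ultimately have "(n - 1 - d v) * real k \<le> (\<Sum>u\<in>?R. d u)"
      by simp
    moreover have "(\<Sum>u\<in>?V. d u) = d v + ((\<Sum>u\<in>?R. d u) + (\<Sum>u \<in> ?E `` {v}. d u))"
      using fin v Nv by (simp add: sum.remove[of ?V v] sum.subset_diff[of "?E `` {v}" "?V - {v}"])
    ultimately show ?thesis
      unfolding E by (simp add: algebra_simps)
  qed
  have "\<mu> * (\<mu> - (real k - 1)) * (\<Sum>u\<in>?V. y u) = (\<mu> - (real k - 1)) * (\<Sum>u\<in>?V. \<mu> * y u)"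
    by (simp flip: sum_distrib_left)
  also have "\<dots> \<le> (\<mu> - (real k - 1)) * (\<Sum>u\<in>?V. z u)"
    using k z by (intro mult_left_mono sum_mono) auto
  also have "\<dots> = (\<Sum>u\<in>?V. \<mu> * z u) - (real k - 1) * (\<Sum>u\<in>?V. z u)"
    by (simp add: algebra_simps flip: sum_distrib_left)
  also have "(\<Sum>u\<in>?V. \<mu> * z u) = (\<Sum>v\<in>?V. \<mu> * (d v * y v))"
    unfolding sum_distrib_left[symmetric] using swap[of "\<lambda>_. 1"] by (simp add: d_def mult.commute)
  also have "\<dots> \<le> (\<Sum>v\<in>?V. d v * z v)"
  proof (intro sum_mono)
    fix v assume "v \<in> ?V"
    then have "d v * (\<mu> * y v) \<le> d v * z v"
      using z by (intro mult_left_mono) (auto simp: d_def)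
    then show "\<mu> * (d v * y v) \<le> d v * z v" by (simp add: mult.left_commute)
  qed
  also have "(\<Sum>v\<in>?V. d v * z v) - (real k - 1) * (\<Sum>u\<in>?V. z u)
      = (\<Sum>v\<in>?V. y v * ((\<Sum>u \<in> ?E `` {v}. d u) - (real k - 1) * d v))"
    using swap[of d] swap[of "\<lambda>_. 1"]
    by (simp add: d_def right_diff_distrib sum_subtractf sum_distrib_left mult_ac)
  also have "\<dots> \<le> (\<Sum>v\<in>?V. y v * (real (card ?E) - (n - 1) * real k))"
    using nbr y0 by (intro sum_mono mult_left_mono) auto
  also have "\<dots> = (real (card ?E) - (n - 1) * real k) * (\<Sum>u\<in>?V. y u)"
    by (simp flip: sum_distrib_right)
  finally have "\<mu> * (\<mu> - (real k - 1)) * (\<Sum>u\<in>?V. y u) \<le> (real (card ?E) - (n - 1) * real k) * (\<Sum>u\<in>?V. y u)"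
    by simp
  moreover have "0 < (\<Sum>u\<in>?V. y u)"
  proof -
    obtain u where "u \<in> ?V" "x u \<noteq> 0" using x(1) by auto
    then show ?thesis
      using fin by (intro sum_pos2[of _ u]) (auto simp: y_def)
  qed
  ultimately show ?thesis by (simp add: n_def)
qed

section \<open>The extremal graph and comparison with it\<close>

text \<open>
  The values \<open>\<alpha>\<close>, \<open>\<beta>\<close>, \<open>c\<close> are those of an eigenvector on \<open>K\<^bsub>a-1\<^esub>\<close>, \<open>K\<^bsub>1\<^esub>\<close> and \<open>K\<^bsub>n-a\<^esub>\<close>; the first class
  is empty for \<open>a = 1\<close>.
\<close>

lemma H_graph_eigenvalue:
  assumes a: "1 \<le> a" "a < n" and nz: "c \<noteq> 0"
    and A: "2 \<le> a \<Longrightarrow> (real a - 2) * \<alpha> + \<beta> + (real n - real a) * c = l * \<alpha>"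
    and B: "(real a - 1) * \<alpha> = l * \<beta>"
    and C: "(real a - 1) * \<alpha> + (real n - real a - 1) * c = l * c"
  shows "l \<in> spectrum (adjacency_matrix (H_graph n a))"
proof -
  let ?H = "H_graph n a"
  let ?x = "case_sum (\<lambda>_. \<alpha>) (case_sum (\<lambda>_. \<beta>) (\<lambda>_. c)) :: nat + nat + nat \<Rightarrow> real"
  have verts: "pverts ?H = {0..<a - 1} <+> ({0..<1} <+> {0..<n - a})"
    by (simp add: H_graph_def graph_join_def disjoint_union_def complete_graph_def)
  have N1: "parcs ?H `` {Inl i} = Inl ` ({0..<a - 1} - {i}) \<union> (Inr ` Inl ` {0} \<union> Inr ` Inr ` {0..<n - a})"
    if "i < a - 1" for i
    using that by (auto simp: H_graph_def graph_join_def disjoint_union_def complete_graph_def)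
  have N2: "parcs ?H `` {Inr (Inl 0)} = Inl ` {0..<a - 1}"
    by (auto simp: H_graph_def graph_join_def disjoint_union_def complete_graph_def)
  have N3: "parcs ?H `` {Inr (Inr i)} = Inl ` {0..<a - 1} \<union> Inr ` Inr ` ({0..<n - a} - {i})"
    if "i < n - a" for i
    using that by (auto simp: H_graph_def graph_join_def disjoint_union_def complete_graph_def)
  have S1: "(\<Sum>v\<in>Inl ` S. ?x v) = real (card S) * \<alpha>" for S
    by (subst sum.reindex) auto
  have S2: "(\<Sum>v\<in>Inr ` Inl ` S. ?x v) = real (card S) * \<beta>" for S
    by (subst sum.reindex, force)+ simp
  have S3: "(\<Sum>v\<in>Inr ` Inr ` S. ?x v) = real (card S) * c" for S
    by (subst sum.reindex, force)+ simp
  have "(\<Sum>v\<in>parcs ?H `` {u}. ?x v) = l * ?x u" if u: "u \<in> pverts ?H" for u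
  proof -
    consider i where "i < a - 1" "u = Inl i" | "u = Inr (Inl 0)" | i where "i < n - a" "u = Inr (Inr i)"
      using u unfolding verts by auto
    then show ?thesis
    proof cases
      case 1
      have "(\<Sum>v\<in>parcs ?H `` {u}. ?x v) = (\<Sum>v\<in>Inl ` ({0..<a - 1} - {i}). ?x v)
          + (\<Sum>v\<in>Inr ` Inl ` {0} \<union> Inr ` Inr ` {0..<n - a}. ?x v)"
        unfolding 1(2) N1[OF 1(1)] by (intro sum.union_disjoint) auto
      also have "(\<Sum>v\<in>Inr ` Inl ` {0} \<union> Inr ` Inr ` {0..<n - a}. ?x v)
          = (\<Sum>v\<in>Inr ` Inl ` {0}. ?x v) + (\<Sum>v\<in>Inr ` Inr ` {0..<n - a}. ?x v)"
        by (intro sum.union_disjoint) auto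
      also have "(\<Sum>v\<in>Inl ` ({0..<a - 1} - {i}). ?x v) = (real a - 2) * \<alpha>"
        unfolding S1 using 1 by (simp add: of_nat_diff)
      finally show ?thesis
        unfolding S2 S3 using 1 a A by (simp add: of_nat_diff add.assoc)
    next
      case 2
      then show ?thesis using a B by (simp add: N2 S1 of_nat_diff)
    next
      case 3
      have "(\<Sum>v\<in>parcs ?H `` {u}. ?x v) = (\<Sum>v\<in>Inl ` {0..<a - 1}. ?x v)
          + (\<Sum>v\<in>Inr ` Inr ` ({0..<n - a} - {i}). ?x v)"
        unfolding 3(2) N3[OF 3(1)] by (intro sum.union_disjoint) auto
      then show ?thesis
        unfolding S1 S3 using 3 a C by (simp add: of_nat_diff algebra_simps)
    qed
  qed
  moreover have "\<exists>u\<in>pverts ?H. ?x u \<noteq> 0"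
    using a nz by (intro bexI[of _ "Inr (Inr 0)"]) (auto simp: verts)
  ultimately show ?thesis
    unfolding eigenvalue_adjacency_matrix_iff[OF pair_graph_H_graph] by (intro exI[of _ ?x] conjI ballI)
qed

text \<open>For \<open>a = 1\<close> there is no positive eigenvector, which is why only inequalities are claimed.\<close>

lemma H_graph_supersolution:
  assumes a: "1 \<le> a" "a + 2 \<le> n"
  obtains l \<alpha> \<beta> c :: real where "real n - 2 \<le> l" "l \<in> spectrum (adjacency_matrix (H_graph n a))"
    "0 < \<alpha>" "0 < \<beta>" "0 < c"
    "2 \<le> a \<Longrightarrow> (real a - 2) * \<alpha> + \<beta> + (real n - real a) * c \<le> l * \<alpha>"
    "(real a - 1) * \<alpha> \<le> l * \<beta>"
    "(real a - 1) * \<alpha> + (real n - real a - 1) * c \<le> l * c"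
proof (cases "a = 1")
  case True
  \<comment> \<open>The eigenvector is 1 on the large clique and 0 on the isolated vertex.\<close>
  have "real n - 2 \<in> spectrum (adjacency_matrix (H_graph n a))"
    using a True by (intro H_graph_eigenvalue[of _ _ 1 0 0]) auto
  then show ?thesis
    using a True by (intro that[of "real n - 2" 1 1 1]) auto
next
  case False
  define k m where "k = real a" and "m = real n"
  have km: "2 \<le> k" "k + 2 \<le> m" using a False by (auto simp: k_def m_def)
  \<comment> \<open>With \<alpha> = 1, the equations at the single vertex and at the large clique
    determine \<beta> and \<open>c\<close> from the eigenvalue \<open>t\<close>; \<open>f t\<close>
    is the defect in the remaining equation.\<close>
  define f where "f t = (k - 2) + (k - 1) / t + (m - k) * (k - 1) / (t - (m - k - 1)) - t" for t
  have "\<exists>t\<ge>m - 2. t \<le> m - 1 \<and> f t = 0"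
  proof (rule IVT2')
    show "m - 2 \<le> m - 1" by simp
    show "continuous_on {m - 2..m - 1} f"
      unfolding f_def using km by (intro continuous_intros) auto
    \<comment> \<open>At \<open>t = m - 2\<close> the last denominator is \<open>k - 1\<close>, so
      that fraction equals \<open>m - k\<close> and cancels with the linear terms.\<close>
    have "f (m - 2) = (k - 1) / (m - 2)"
      using km by (simp add: f_def)
    then show "0 \<le> f (m - 2)" using km by simp
    have "(k - 1) / (m - 1) \<le> 1" using km by simp
    moreover have "(m - k) * (k - 1) / k \<le> m - k"
      using km by (simp add: divide_le_eq mult_left_mono)
    ultimately show "f (m - 1) \<le> 0" by (simp add: f_def)
  qed
  then obtain l where l: "m - 2 \<le> l" "f l = 0" by auto
  have pos: "0 < l" "0 < l - (m - k - 1)" using l km by auto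
  define \<beta> c where "\<beta> = (k - 1) / l" and "c = (k - 1) / (l - (m - k - 1))"
  have A: "(k - 2) * 1 + \<beta> + (m - k) * c = l * 1"
    using l(2) by (simp add: f_def \<beta>_def c_def)
  have B: "(k - 1) * 1 = l * \<beta>"
    using pos by (simp add: \<beta>_def)
  have "(l - (m - k - 1)) * c = k - 1"
    using pos by (simp add: c_def)
  then have C: "(k - 1) * 1 + (m - k - 1) * c = l * c"
    by (simp add: algebra_simps)
  have p: "0 < \<beta>" "0 < c" using pos km by (simp_all add: \<beta>_def c_def)
  have "l \<in> spectrum (adjacency_matrix (H_graph n a))"
    using a p A B C unfolding k_def m_def by (intro H_graph_eigenvalue[of a n c 1 \<beta> l]) auto
  with l p A B C show ?thesis
    unfolding k_def m_def by (intro that[of l 1 \<beta> c]) auto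
qed

lemma eigenvalue_le_H_graph_radius:
  assumes "1 \<le> a" "a + 2 \<le> n" "l \<in> spectrum (adjacency_matrix (H_graph n a))"
  shows "l \<le> graph_spectral_radius (H_graph n a)"
proof -
  have "pverts (H_graph n a) \<noteq> {}"
    using card_H_graph[of a n] assms by auto
  then show ?thesis
    using adjacency_matrix_spectrum(1)[OF pair_graph_H_graph] assms(3)
    unfolding graph_spectral_radius_def by (intro Max_ge) auto
qed

text \<open>The neighbours of \<open>w\<close> are enlarged to a set \<open>S\<close> of
  \<open>a - 1\<close> vertices. With \<open>S\<close>, \<open>w\<close> and the remaining vertices
  as the three classes of \<open>H_graph n a\<close>, every neighbourhood in \<open>G\<close> lies
  in the corresponding one of that graph, so its supersolution is one for \<open>G\<close>.\<close>

lemma spectral_radius_le_H_graph: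
  assumes G: "pair_graph G" and n: "card (pverts G) = n" and a: "1 \<le> a" "a + 2 \<le> n"
    and w: "w \<in> pverts G" "card (parcs G `` {w}) < a"
  shows "graph_spectral_radius G \<le> graph_spectral_radius (H_graph n a)"
proof -
  let ?V = "pverts G" and ?E = "parcs G"
  have fin: "finite ?V" and sub: "?E \<subseteq> ?V \<times> ?V" and sym: "sym ?E" and irr: "irrefl ?E"
    using pair_graphD[OF G] by auto
  obtain l \<alpha> \<beta> c where l: "l \<in> spectrum (adjacency_matrix (H_graph n a))"
    and pos: "0 < \<alpha>" "0 < \<beta>" "0 < c"
    and A: "2 \<le> a \<Longrightarrow> (real a - 2) * \<alpha> + \<beta> + (real n - real a) * c \<le> l * \<alpha>"
    and B: "(real a - 1) * \<alpha> \<le> l * \<beta>"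
    and C: "(real a - 1) * \<alpha> + (real n - real a - 1) * c \<le> l * c"
    using H_graph_supersolution[OF a] by metis
  have Nw: "?E `` {w} \<subseteq> ?V - {w}" using sub irr by (auto simp: irrefl_def)
  have "card (?V - {w}) = n - 1" using w n fin by simp
  then have "\<exists>S. ?E `` {w} \<subseteq> S \<and> S \<subseteq> ?V - {w} \<and> card S = a - 1"
    using Nw w a fin by (intro exists_subset_between) auto
  then obtain S where S: "?E `` {w} \<subseteq> S" "S \<subseteq> ?V - {w}" "card S = a - 1"
    by auto
  have finS: "finite S" using S fin finite_subset by blast
  define y where "y u = (if u \<in> S then \<alpha> else if u = w then \<beta> else c)" for u
  let ?R = "?V - {w} - S"
  have cR: "card ?R = n - a"
    using S w n fin finS a by (simp add: card_Diff_subset)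
  have yS: "(\<Sum>v\<in>T. y v) = real (card T) * \<alpha>" if "T \<subseteq> S" for T
    using that by (simp add: y_def subset_iff cong: sum.cong)
  have yR: "(\<Sum>v\<in>T. y v) = real (card T) * c" if "T \<subseteq> ?R" for T
  proof -
    have "(\<Sum>v\<in>T. y v) = (\<Sum>v\<in>T. c)" using that by (intro sum.cong) (auto simp: y_def)
    then show ?thesis by simp
  qed
  have y0: "0 < y u" for u using pos by (simp add: y_def)
  have mono: "(\<Sum>v\<in>?E `` {u}. y v) \<le> (\<Sum>v\<in>T. y v)" if "?E `` {u} \<subseteq> T" "finite T" for u T
    using that y0 by (intro sum_mono2) (auto intro: less_imp_le)
  have super: "(\<Sum>v\<in>?E `` {u}. y v) \<le> l * y u" if u: "u \<in> ?V" for u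
  proof -
    consider "u \<in> S" | "u = w" | "u \<in> ?R" using u by auto
    then show ?thesis
    proof cases
      case 1
      \<comment> \<open>The inequality \<open>A\<close> is available only when the first class is
        nonempty.\<close>
      have a2: "2 \<le> a" using 1 S(3) finS card_gt_0_iff[of S] by auto
      have "?E `` {u} \<subseteq> (S - {u}) \<union> insert w ?R"
        using sub irr by (auto simp: irrefl_def)
      then have "(\<Sum>v\<in>?E `` {u}. y v) \<le> (\<Sum>v\<in>(S - {u}) \<union> insert w ?R. y v)"
        using finS fin by (intro mono) auto
      also have "\<dots> = (\<Sum>v\<in>S - {u}. y v) + (y w + (\<Sum>v\<in>?R. y v))"
        using finS fin S(2) by (subst sum.union_disjoint) auto
      also have "\<dots> = (real a - 2) * \<alpha> + \<beta> + (real n - real a) * c"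
        using 1 S finS cR a a2 yS[of "S - {u}"] yR[of ?R] by (auto simp: y_def of_nat_diff)
      finally show ?thesis using A[OF a2] 1 by (simp add: y_def)
    next
      case 2
      have "(\<Sum>v\<in>?E `` {u}. y v) \<le> (\<Sum>v\<in>S. y v)"
        using S finS 2 by (intro mono) auto
      then show ?thesis using B yS[of S] S 2 a by (auto simp: y_def of_nat_diff)
    next
      case 3
      then have "(w, u) \<notin> ?E" using S by auto
      then have "?E `` {u} \<subseteq> S \<union> (?R - {u})"
        using sub irr sym by (auto simp: irrefl_def dest: symD)
      then have "(\<Sum>v\<in>?E `` {u}. y v) \<le> (\<Sum>v\<in>S \<union> (?R - {u}). y v)"
        using finS fin by (intro mono) auto
      also have "\<dots> = (\<Sum>v\<in>S. y v) + (\<Sum>v\<in>?R - {u}. y v)"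
        using finS fin by (subst sum.union_disjoint) auto
      also have "\<dots> = (real a - 1) * \<alpha> + (real n - real a - 1) * c"
      proof -
        have "card (?R - {u}) = n - a - 1" using 3 cR fin by simp
        then show ?thesis using S(3) a yS[of S] yR[of "?R - {u}"] by (auto simp: of_nat_diff)
      qed
      finally show ?thesis using C 3 by (simp add: y_def)
    qed
  qed
  have "graph_spectral_radius G \<in> spectrum (adjacency_matrix G)"
    using w by (intro adjacency_matrix_spectrum(2)[OF G]) auto
  then have "graph_spectral_radius G \<le> l"
    by (rule eigenvalue_le_supersolution[OF G _ y0 super])
  also have "l \<le> graph_spectral_radius (H_graph n a)"
    using eigenvalue_le_H_graph_radius[OF a l] .
  finally show ?thesis .
qed

section \<open>The factor theorem\<close>

lemma card_complement_on:
  assumes "finite V" "simple_on V E"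
  shows "card (complement_on V E) + card E + card V = card V * card V"
proof -
  have "complement_on V E = V \<times> V - (Id_on V \<union> E)"
    by (auto simp: complement_on_def)
  moreover have "Id_on V \<union> E \<subseteq> V \<times> V" "Id_on V \<inter> E = {}" "finite E" "finite (Id_on V)"
    using assms finite_simple_on by (auto simp: simple_on_def irrefl_def Id_on_def)
  moreover have "card (Id_on V) = card V"
    unfolding Id_on_def using assms by (subst card_UN_disjoint) auto
  ultimately have "card (complement_on V E) = card (V \<times> V) - (card V + card E)"
      "card V + card E \<le> card (V \<times> V)"
    using assms card_mono[of "V \<times> V" "Id_on V \<union> E"]
    by (auto simp: card_Diff_subset card_Un_disjoint)
  then show ?thesis
    by (simp add: card_cartesian_product)
qed

theorem theorem1p3:
  fixes G :: "'v pair_pre_digraph" and a b n :: nat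
  assumes "1 \<le> a" and "a \<le> b" and "3 * a + b - 1 \<le> n" and "even (a * n)"
    and "pair_graph G" and "card (pverts G) = n"
    and "graph_spectral_radius G > graph_spectral_radius (H_graph n a)"
  shows "\<exists>F. ab_factor a b F G"
proof -
  let ?V = "pverts G" and ?E = "parcs G"
  note G = \<open>pair_graph G\<close> and n = \<open>card ?V = n\<close>
  have V: "finite ?V" and E: "simple_on ?V ?E"
    using pair_graphD[OF G] by (auto simp: simple_on_def)
  have a: "1 \<le> a" "a + 2 \<le> n" "4 * a \<le> n + 1" using assms(1-3) by auto
  define \<rho> where "\<rho> = graph_spectral_radius G"
  have mindeg: "a \<le> card (?E `` {u})" if "u \<in> ?V" for u
    using spectral_radius_le_H_graph[OF G n a(1,2) that] assms(7) by (meson not_le)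
  have \<rho>: "real n - 2 < \<rho>"
  proof -
    obtain l where "real n - 2 \<le> l" "l \<in> spectrum (adjacency_matrix (H_graph n a))"
      using H_graph_supersolution[OF a(1,2)] by metis
    then show ?thesis
      using eigenvalue_le_H_graph_radius[OF a(1,2)] assms(7) unfolding \<rho>_def by fastforce
  qed
  have "\<rho> \<in> spectrum (adjacency_matrix G)"
    unfolding \<rho>_def using a n by (intro adjacency_matrix_spectrum(2)[OF G]) auto
  then have "\<rho> * (\<rho> - (real a - 1)) \<le> real (card ?E) - (real n - 1) * real a"
    using spectral_radius_edge_bound[OF G, of \<rho> a] mindeg a \<rho> n by auto
  \<comment> \<open>Both factors on the left are positive because \<open>a + 2 \<le> n\<close>, so
    the product is monotone.\<close>
  moreover have "(real n - 2) * (real n - 2 - (real a - 1)) < \<rho> * (\<rho> - (real a - 1))"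
    using \<rho> a by (intro mult_strict_mono) auto
  \<comment> \<open>The products of \<open>a\<close> and \<open>n\<close> cancel, which leaves a
    bound linear in \<open>a\<close>.\<close>
  ultimately have "real n * real n + real a < real (card ?E) + 3 * real n - 2"
    by (simp add: algebra_simps)
  moreover have "real (card (complement_on ?V ?E)) + real (card ?E) + real n = real n * real n"
    using card_complement_on[OF V E] n by (metis of_nat_add of_nat_mult)
  ultimately have "real (card (complement_on ?V ?E)) + real a + 2 < 2 * real n"
    by linarith
  \<comment> \<open>Integrality turns the strict inequality with 2 into a weak one with 3.\<close>
  then have "card (complement_on ?V ?E) + 3 + a \<le> 2 * card ?V"
    using n by linarith
  then obtain F where F: "regular_on ?V a F" "F \<subseteq> ?E"
    using ex_regular_factor[OF V E a(1)] a(3) assms(4) mindeg n by auto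
  let ?F = "\<lparr>pverts = ?V, parcs = F\<rparr>"
  have pF: "pair_graph ?F"
    using F(1) V by (intro pair_graphI) (auto simp: regular_on_def simple_on_def)
  have "out_degree (with_proj ?F) v = a" if "v \<in> ?V" for v
  proof -
    have "out_arcs (with_proj ?F) v = {v} \<times> F `` {v}"
      by (auto simp: out_arcs_def)
    then show ?thesis
      using F(1) that by (simp add: out_degree_def card_cartesian_product regular_on_def)
  qed
  moreover have "spanning (with_proj ?F) (with_proj G)"
  proof -
    interpret G: pair_graph G by fact
    interpret F: pair_graph ?F by fact
    show ?thesis
      using F(2) G.wf_digraph_axioms F.wf_digraph_axioms
      by (simp add: spanning_def subgraph_def compatible_def)
  qed
  ultimately show ?thesis
    using pF assms(2) unfolding ab_factor_def by (intro exI[of _ ?F]) auto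
qed

end
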